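(* Let $N_f$ be the degree of the interpolation polynomial, with $q=2$ when $N_f$ is even and $q=1$ when $N_f$ is odd. Let $h=\frac{\pi}{N}$ and $h_g=k_gh$ with $k_g$ an integer, $0\le k_g\le N$, where $h_g$ is not reduced as $N$ increases, and $N-k_g$ is even when $N_f$ is even. Split $[h_g,\pi]$ into the consecutive regions $\left((k_g+qm)h,(k_g+q(m+1))h\right)$ with centres $c_m=\left(k_g+q\left(m+\frac12\right)\right)h$, $m=0,\dots,\frac{N-k_g}{q}-1$. For each region $m$ and each frequency $n=0,\dots,N$, let the weights $\mathbf b_0^{n,m},\dots,\mathbf b_{N_f}^{n,m}$ be determined by the moment conditions $$h^k\sum_{j=0}^{N_f}\left(j-\frac{N_f}{2}\right)^k\mathbf b_j^{n,m}=\int_{-\frac{qh}{2}}^{\frac{qh}{2}}\cos\left(n(x+c_m)\right)x^k\,dx,\qquad k=0,\dots,N_f .$$ Let $f$ be analytic within the integration limits, including the endpoints. Then the quadrature rule $$\int_{(k_g+qm)h}^{(k_g+q(m+1))h}\cos(nx)f(x)\,dx\approx\sum_{j=0}^{N_f}f\left(\left(k_g+q(m+1)-1+j-\left\lfloor\frac{N_f}{2}\right\rfloor\right)h\right)\mathbf b_j^{n,m},$$ summed over all regions $m$ to approximate $\int_{h_g}^{\pi}\cos(nx)f(x)\,dx$, has global error order $$N_s=N_f+q .$$ For even $N_f$ the local integration error over one region is $O(h^{N_f+3})$.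
   Context: This is a higher-order generalisation of the Filon method for the oscillatory weight $\cos(nx)$. The nodes $\left(k_g+q(m+1)-1+j-\lfloor N_f/2\rfloor\right)h$ equal $c_m+\left(j-\frac{N_f}{2}\right)h$, $j=0,\dots,N_f$. They are equidistant and centred at $c_m$, and for larger $N_f$ some lie outside the region of integration. In the intended application $f$ is the spectrum (discrete-time Fourier transform) of a stencil, which is cyclic and symmetric about $\pi$, so that nodes out of bound are replaced by mirrored points. The convention $0^0=1$ is used. *)

theory Defs
  imports "HOL-Analysis.Analysis" "HOL-Library.Landau_Symbols"
begin

text \<open>
  Real-analyticity at a point: \<open>f\<close> is the sum of a convergent power series on a two-sided
  neighbourhood. Analyticity at every point of a closed interval therefore extends slightly
  beyond its endpoints.
\<close>
definition real_analytic_at :: "(real \<Rightarrow> complex) \<Rightarrow> real \<Rightarrow> bool" where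
  "real_analytic_at f x \<longleftrightarrow>
     (\<exists>r>0. \<exists>a. \<forall>y. \<bar>y - x\<bar> < r \<longrightarrow> (\<lambda>k. ((y - x) ^ k) *\<^sub>R a k) sums f y)"

definition region_width :: "nat \<Rightarrow> nat" where
  "region_width Nf = (if even Nf then 2 else 1)"

definition grid_step :: "nat \<Rightarrow> real" where
  "grid_step N = pi / real N"

definition region_count :: "nat \<Rightarrow> nat \<Rightarrow> nat \<Rightarrow> nat" where
  "region_count Nf N kg = (N - kg) div region_width Nf"

definition region_left :: "nat \<Rightarrow> nat \<Rightarrow> nat \<Rightarrow> nat \<Rightarrow> real" where
  "region_left Nf N kg m = real (kg + region_width Nf * m) * grid_step N"

definition region_centre :: "nat \<Rightarrow> nat \<Rightarrow> nat \<Rightarrow> nat \<Rightarrow> real" where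
  "region_centre Nf N kg m =
     (real kg + real (region_width Nf) * (real m + 1 / 2)) * grid_step N"

definition moment_conditions ::
    "nat \<Rightarrow> nat \<Rightarrow> nat \<Rightarrow> nat \<Rightarrow> nat \<Rightarrow> (nat \<Rightarrow> real) \<Rightarrow> bool" where
  "moment_conditions Nf N kg n m b \<longleftrightarrow>
     (let h = grid_step N; q = real (region_width Nf); c = region_centre Nf N kg m in
      \<forall>k\<le>Nf. h ^ k * (\<Sum>j\<le>Nf. (real j - real Nf / 2) ^ k * b j) =
             integral {- (q * h / 2)..q * h / 2} (\<lambda>x. cos (real n * (x + c)) * x ^ k))"

text \<open>
  The moment conditions only concern the entries \<open>0, \<dots>, Nf\<close>; the weight vector is padded with
  zeros so that, as a function on the naturals, it is the unique solution of the conditions.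
\<close>
definition filon_weights :: "nat \<Rightarrow> nat \<Rightarrow> nat \<Rightarrow> nat \<Rightarrow> nat \<Rightarrow> nat \<Rightarrow> real" where
  "filon_weights Nf N kg n m = (THE b. moment_conditions Nf N kg n m b \<and> (\<forall>j>Nf. b j = 0))"

text \<open>The node index can be negative, so the subtractions are carried out in the reals.\<close>
definition filon_node :: "nat \<Rightarrow> nat \<Rightarrow> nat \<Rightarrow> nat \<Rightarrow> nat \<Rightarrow> real" where
  "filon_node Nf N kg m j =
     (real kg + real (region_width Nf) * (real m + 1) - 1 + real j - real (Nf div 2)) * grid_step N"

definition filon_rule ::
    "nat \<Rightarrow> nat \<Rightarrow> nat \<Rightarrow> nat \<Rightarrow> nat \<Rightarrow> (real \<Rightarrow> complex) \<Rightarrow> complex" where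
  "filon_rule Nf N kg n m f =
     (\<Sum>j\<le>Nf. filon_weights Nf N kg n m j *\<^sub>R f (filon_node Nf N kg m j))"

definition local_error ::
    "nat \<Rightarrow> nat \<Rightarrow> nat \<Rightarrow> nat \<Rightarrow> nat \<Rightarrow> (real \<Rightarrow> complex) \<Rightarrow> complex" where
  "local_error Nf N kg n m f =
     integral {region_left Nf N kg m..region_left Nf N kg (m + 1)}
       (\<lambda>x. cos (real n * x) *\<^sub>R f x) - filon_rule Nf N kg n m f"

text \<open>
  Error orders refer to a fixed frequency \<open>n\<close> while the grid is refined. They do not hold uniformly
  in \<open>n \<le> N\<close>: for even \<open>Nf\<close> and \<open>n = N - 1\<close> the global error is in general only of order
  \<open>Nf + 1\<close>.
\<close>
definition global_error ::
    "nat \<Rightarrow> nat \<Rightarrow> nat \<Rightarrow> nat \<Rightarrow> (real \<Rightarrow> complex) \<Rightarrow> complex" where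
  "global_error Nf N kg n f =
     integral {real kg * grid_step N..pi} (\<lambda>x. cos (real n * x) *\<^sub>R f x)
       - (\<Sum>m<region_count Nf N kg. filon_rule Nf N kg n m f)"

end

theory Submission
  imports Defs "HOL-Complex_Analysis.Cauchy_Integral_Formula" "HOL-Computational_Algebra.Polynomial"
begin

text \<open>
  The weights are the integrals of \<open>cos (n (x + c))\<close> against the Lagrange basis at the scaled
  centred nodes; hence they are \<open>O(h)\<close>, and the rule integrates polynomials of degree at most \<open>Nf\<close>
  exactly. Expanding \<open>f\<close> about the centre of a region, the local error consists of the Taylor
  remainder and, for even \<open>Nf\<close>, of the error of the rule on \<open>x ^ (Nf + 1)\<close>. That power minus its
  interpolant is an odd function, so its integral against the constant \<open>cos (n c)\<close> vanishes, and
  replacing \<open>cos (n (x + c))\<close> by \<open>cos (n c)\<close> costs a factor \<open>n h\<close>, which is the gain of one order.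
  Analyticity on a compact interval makes the Taylor bounds uniform in the region, also at nodes
  slightly outside the interval, and the number of regions is at most \<open>pi / h\<close>.
\<close>

section \<open>Lagrange interpolation at centred equidistant nodes\<close>

text \<open>Position of node \<open>j\<close> relative to the region centre, in units of the step;
  half-integral for odd \<open>n\<close>.\<close>

definition offset :: "nat \<Rightarrow> nat \<Rightarrow> real" where
  "offset n j = real j - real n / 2"

text \<open>The basis lives in the scaled variable \<open>s = x / h\<close>, so it does not depend
  on the grid and a single bound serves all \<open>N\<close>.\<close>

definition lagrange_poly :: "nat \<Rightarrow> nat \<Rightarrow> real poly" where
  "lagrange_poly n j =
     (\<Prod>i\<in>{..n} - {j}. smult (1 / (offset n j - offset n i)) [:- offset n i, 1:])"

lemma offset_eq_iff: "offset n i = offset n j \<longleftrightarrow> i = j"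
  by (simp add: offset_def)

lemma offset_diff: "j \<le> n \<Longrightarrow> offset n (n - j) = - offset n j"
  by (simp add: offset_def of_nat_diff)

lemma abs_offset_le: "j \<le> n \<Longrightarrow> \<bar>offset n j\<bar> \<le> real n"
  by (simp add: offset_def abs_le_iff)

lemma degree_lagrange_poly:
  assumes "j \<le> n"
  shows "degree (lagrange_poly n j) \<le> n"
proof -
  have "degree (lagrange_poly n j) \<le>
      (\<Sum>i\<in>{..n} - {j}. (degree \<circ> (\<lambda>i. smult (1 / (offset n j - offset n i)) [:- offset n i, 1:])) i)"
    unfolding lagrange_poly_def by (rule degree_prod_sum_le) simp
  also have "\<dots> \<le> (\<Sum>i\<in>{..n} - {j}. 1)"
    by (rule sum_mono) (simp add: o_def)
  also have "\<dots> = n"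
    using assms by simp
  finally show ?thesis .
qed

lemma poly_lagrange_poly_offset:
  assumes "i \<le> n" "j \<le> n"
  shows "poly (lagrange_poly n j) (offset n i) = (if i = j then 1 else 0)"
proof (cases "i = j")
  case True
  then show ?thesis
    by (simp add: lagrange_poly_def poly_prod offset_eq_iff diff_divide_distrib [symmetric])
next
  case False
  then show ?thesis
    using assms by (auto simp: lagrange_poly_def poly_prod)
qed

text \<open>Both sides are polynomials in \<open>s\<close> of degree at most \<open>n\<close> that
  agree at \<open>n + 1\<close> distinct offsets.\<close>

lemma lagrange_interpolation:
  assumes "degree p \<le> n"
  shows "(\<Sum>j\<le>n. poly p (offset n j) * poly (lagrange_poly n j) s) = poly p s"
proof -
  define r where "r = (\<Sum>j\<le>n. smult (poly p (offset n j)) (lagrange_poly n j))"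
  have "r = p"
  proof (rule poly_eqI_degree [where A = "offset n ` {..n}"])
    fix x assume "x \<in> offset n ` {..n}"
    then obtain i where i: "i \<le> n" "x = offset n i" by auto
    have "poly r x = (\<Sum>j\<le>n. if i = j then poly p (offset n j) else 0)"
      unfolding r_def poly_sum
      by (rule sum.cong) (auto simp: i poly_lagrange_poly_offset)
    then show "poly r x = poly p x"
      using i by simp
  next
    have card: "card (offset n ` {..n}) = Suc n"
      by (subst card_image) (auto simp: inj_on_def offset_eq_iff)
    have "degree r \<le> n"
      unfolding r_def
      by (rule degree_sum_le) (auto intro: order.trans [OF degree_smult_le] degree_lagrange_poly)
    then show "card (offset n ` {..n}) > degree r"
      by (simp add: card)
    show "card (offset n ` {..n}) > degree p"
      using assms by (simp add: card)
  qed
  then have "poly p s = poly r s" by simp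
  then show ?thesis
    by (simp add: r_def poly_sum)
qed

lemma lagrange_interpolation_power:
  assumes "k \<le> n"
  shows "(\<Sum>j\<le>n. offset n j ^ k * poly (lagrange_poly n j) s) = s ^ k"
  using lagrange_interpolation [of "monom 1 k" n s] assms
  by (simp add: poly_monom degree_monom_eq)

text \<open>Reflection permutes the offsets and changes the sign of odd powers, so the reflected
  interpolant \<open>p\<close> takes the negated node values; uniqueness of interpolation does the
  rest. There is no bound on \<open>k\<close>: the lemma is applied with \<open>k = n + 1\<close>,
  where interpolation is no longer exact.\<close>

lemma interpolant_odd_power:
  assumes "odd k"
  shows "(\<Sum>j\<le>n. offset n j ^ k * poly (lagrange_poly n j) (- s)) =
         - (\<Sum>j\<le>n. offset n j ^ k * poly (lagrange_poly n j) s)"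
proof -
  define p where "p = (\<Sum>j\<le>n. smult (offset n j ^ k) (pcompose (lagrange_poly n j) [:0, -1:]))"
  have poly_p: "poly p x = (\<Sum>j\<le>n. offset n j ^ k * poly (lagrange_poly n j) (- x))" for x
    by (simp add: p_def poly_sum poly_pcompose)
  have "degree p \<le> n"
    unfolding p_def
    by (rule degree_sum_le)
       (auto intro!: order.trans [OF degree_smult_le] order.trans [OF degree_pcompose_le]
          degree_lagrange_poly)
  moreover have "poly p (offset n i) = - (offset n i ^ k)" if "i \<le> n" for i
  proof -
    \<comment> \<open>Since \<open>- offset n i\<close> is the offset of index \<open>n - i\<close>,
      only that basis polynomial survives.\<close>
    have "poly p (offset n i) = (\<Sum>j\<le>n. if n - i = j then offset n j ^ k else 0)"
      unfolding poly_p
      by (rule sum.cong)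
         (use that in \<open>auto simp: offset_diff [OF that, symmetric] poly_lagrange_poly_offset\<close>)
    then show ?thesis
      using assms that by (simp add: offset_diff)
  qed
  ultimately have "poly p s = (\<Sum>j\<le>n. - (offset n j ^ k) * poly (lagrange_poly n j) s)"
    using lagrange_interpolation [of p n s] by simp
  then show ?thesis
    by (simp add: poly_p sum_negf)
qed

text \<open>The range \<open>\<bar>s\<bar> \<le> 1\<close> suffices because half the width of a
  region is at most one step.\<close>

lemma lagrange_poly_bound:
  obtains B where "B \<ge> 0" "\<And>j s. j \<le> n \<Longrightarrow> \<bar>s\<bar> \<le> 1 \<Longrightarrow> \<bar>poly (lagrange_poly n j) s\<bar> \<le> B"
proof -
  have "compact (\<Union>j\<le>n. poly (lagrange_poly n j) ` {-1..1})"
    by (intro compact_UN compact_continuous_image continuous_intros) auto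
  then obtain B where "\<forall>x\<in>(\<Union>j\<le>n. poly (lagrange_poly n j) ` {-1..1}). norm x \<le> B"
    using compact_imp_bounded bounded_iff by metis
  then have B: "\<bar>poly (lagrange_poly n j) s\<bar> \<le> B" if "j \<le> n" "\<bar>s\<bar> \<le> 1" for j s
    using that by (auto simp: abs_le_iff)
  show ?thesis
    using B abs_ge_zero [THEN order.trans, OF B [of 0 0]] by (intro that [of B]) auto
qed

section \<open>The weights\<close>

lemma grid_step_pos: "N > 0 \<Longrightarrow> grid_step N > 0"
  by (simp add: grid_step_def)

abbreviation reference_region :: "nat \<Rightarrow> nat \<Rightarrow> real set" where
  "reference_region Nf N \<equiv>
     {- (real (region_width Nf) * grid_step N / 2)..real (region_width Nf) * grid_step N / 2}"

lemma half_region_width_le: "h \<ge> 0 \<Longrightarrow> real (region_width Nf) * h / 2 \<le> h"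
  by (simp add: region_width_def)

text \<open>The difference of two solutions annihilates all powers up to \<open>Nf\<close>, hence
  all polynomials of degree at most \<open>Nf\<close>; testing it on the \<open>i\<close>-th
  Lagrange polynomial isolates its \<open>i\<close>-th entry.\<close>

lemma moment_conditions_unique:
  assumes "N > 0" "moment_conditions Nf N kg n m b" "moment_conditions Nf N kg n m b'" "i \<le> Nf"
  shows "b i = b' i"
proof -
  have pow: "(\<Sum>j\<le>Nf. offset Nf j ^ k * (b j - b' j)) = 0" if "k \<le> Nf" for k
  proof -
    have "grid_step N ^ k * (\<Sum>j\<le>Nf. offset Nf j ^ k * b j) =
          grid_step N ^ k * (\<Sum>j\<le>Nf. offset Nf j ^ k * b' j)"
      using assms(2)[unfolded moment_conditions_def Let_def, rule_format, OF that]
        assms(3)[unfolded moment_conditions_def Let_def, rule_format, OF that]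
      unfolding offset_def by (rule trans [OF _ sym])
    then show ?thesis
      using grid_step_pos [OF assms(1)] by (simp add: right_diff_distrib sum_subtractf)
  qed
  define p where "p = lagrange_poly Nf i"
  have "(\<Sum>j\<le>Nf. poly p (offset Nf j) * (b j - b' j)) =
        (\<Sum>j\<le>Nf. \<Sum>k\<le>degree p. coeff p k * (offset Nf j ^ k * (b j - b' j)))"
    by (simp add: poly_altdef sum_distrib_right mult.assoc)
  also have "\<dots> = (\<Sum>k\<le>degree p. coeff p k * (\<Sum>j\<le>Nf. offset Nf j ^ k * (b j - b' j)))"
    by (subst sum.swap) (simp add: sum_distrib_left)
  also have "\<dots> = 0"
    using degree_lagrange_poly [OF assms(4)]
    by (intro sum.neutral) (auto simp: pow p_def)
  finally have "(\<Sum>j\<le>Nf. poly p (offset Nf j) * (b j - b' j)) = 0" .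
  moreover have "(\<Sum>j\<le>Nf. poly p (offset Nf j) * (b j - b' j)) =
      (\<Sum>j\<le>Nf. if j = i then b j - b' j else 0)"
    by (rule sum.cong) (auto simp: p_def poly_lagrange_poly_offset assms(4))
  ultimately show ?thesis
    using assms(4) by simp
qed

text \<open>After exchanging sum and integral, interpolation reproduces \<open>(x / h) ^ k\<close>
  exactly, and the factor \<open>h ^ k\<close> turns it into \<open>x ^ k\<close>.\<close>

lemma moment_conditions_lagrange:
  assumes "N > 0"
    and b: "\<And>j. j \<le> Nf \<Longrightarrow> b j =
      integral (reference_region Nf N)
        (\<lambda>x. cos (real n * (x + region_centre Nf N kg m)) * poly (lagrange_poly Nf j) (x / grid_step N))"
  shows "moment_conditions Nf N kg n m b"
proof -
  define h c I where "h = grid_step N" and "c = region_centre Nf N kg m"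
    and "I = {- (real (region_width Nf) * h / 2)..real (region_width Nf) * h / 2}"
  have h: "h > 0" using grid_step_pos [OF assms(1)] by (simp add: h_def)
  have "h ^ k * (\<Sum>j\<le>Nf. offset Nf j ^ k * b j) =
        integral I (\<lambda>x. cos (real n * (x + c)) * x ^ k)" if "k \<le> Nf" for k
  proof -
    have "h ^ k * (\<Sum>j\<le>Nf. offset Nf j ^ k * b j) =
      (\<Sum>j\<le>Nf. integral I (\<lambda>x. h ^ k * offset Nf j ^ k *
         (cos (real n * (x + c)) * poly (lagrange_poly Nf j) (x / h))))"
      by (simp add: b sum_distrib_left I_def c_def h_def mult.assoc)
    also have "\<dots> = integral I (\<lambda>x. \<Sum>j\<le>Nf. h ^ k * offset Nf j ^ k *
         (cos (real n * (x + c)) * poly (lagrange_poly Nf j) (x / h)))"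
      unfolding I_def using h
      by (intro integral_sum [symmetric] integrable_continuous_real continuous_intros) auto
    also have "(\<lambda>x. \<Sum>j\<le>Nf. h ^ k * offset Nf j ^ k *
         (cos (real n * (x + c)) * poly (lagrange_poly Nf j) (x / h))) =
       (\<lambda>x. cos (real n * (x + c)) * h ^ k *
         (\<Sum>j\<le>Nf. offset Nf j ^ k * poly (lagrange_poly Nf j) (x / h)))"
      by (simp add: sum_distrib_left algebra_simps)
    also have "\<dots> = (\<lambda>x. cos (real n * (x + c)) * x ^ k)"
      using h by (simp add: lagrange_interpolation_power [OF that] power_divide)
    finally show ?thesis .
  qed
  then show ?thesis
    unfolding moment_conditions_def Let_def by (simp add: h_def c_def I_def offset_def)
qed

text \<open>Existence and uniqueness resolve the definite description. The zero padding makes the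
  solution unique as a function on all naturals.\<close>

lemma filon_weights_eq:
  assumes "N > 0" "j \<le> Nf"
  shows "filon_weights Nf N kg n m j =
      integral (reference_region Nf N)
        (\<lambda>x. cos (real n * (x + region_centre Nf N kg m)) * poly (lagrange_poly Nf j) (x / grid_step N))"
    (is "_ = ?w j")
proof -
  define w where "w j = (if j \<le> Nf then ?w j else 0)" for j
  have w: "moment_conditions Nf N kg n m w"
    by (rule moment_conditions_lagrange [OF assms(1)]) (simp add: w_def)
  have "filon_weights Nf N kg n m = w"
    unfolding filon_weights_def
  proof (rule the_equality)
    show "moment_conditions Nf N kg n m w \<and> (\<forall>j>Nf. w j = 0)"
      using w by (simp add: w_def)
  next
    fix b assume b: "moment_conditions Nf N kg n m b \<and> (\<forall>j>Nf. b j = 0)"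
    show "b = w"
    proof
      fix i show "b i = w i"
        using b moment_conditions_unique [OF assms(1) _ w, of b i]
        by (cases "i \<le> Nf") (auto simp: w_def)
    qed
  qed
  then show ?thesis
    using assms(2) by (simp add: w_def)
qed

lemma moment_conditions_filon_weights:
  "N > 0 \<Longrightarrow> moment_conditions Nf N kg n m (filon_weights Nf N kg n m)"
  by (rule moment_conditions_lagrange) (auto intro: filon_weights_eq)

text \<open>The integrand is bounded by the bound for the Lagrange basis and the interval has length
  at most \<open>2 * h\<close>. The constant depends on \<open>Nf\<close> only.\<close>

lemma filon_weights_bound:
  obtains B where "B \<ge> 0"
    "\<And>N kg n m j. N > 0 \<Longrightarrow> j \<le> Nf \<Longrightarrow> \<bar>filon_weights Nf N kg n m j\<bar> \<le> B * grid_step N"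
proof -
  obtain L where L: "L \<ge> 0" "\<And>j s. j \<le> Nf \<Longrightarrow> \<bar>s\<bar> \<le> 1 \<Longrightarrow> \<bar>poly (lagrange_poly Nf j) s\<bar> \<le> L"
    by (rule lagrange_poly_bound [of Nf]) blast
  show ?thesis
  proof
    show "2 * L \<ge> 0" using L by simp
    fix N kg n m j :: nat assume N: "N > 0" and j: "j \<le> Nf"
    define h c a where "h = grid_step N" and "c = region_centre Nf N kg m"
      and "a = real (region_width Nf) * h / 2"
    have h: "h > 0" using grid_step_pos [OF N] by (simp add: h_def)
    have a: "0 \<le> a" "a \<le> h" using half_region_width_le [of h] h by (auto simp: a_def)
    have "norm (integral {-a..a} (\<lambda>x. cos (real n * (x + c)) * poly (lagrange_poly Nf j) (x / h)))
        \<le> L * (a - - a)"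
    proof (rule integral_bound)
      fix x assume "x \<in> {-a..a}"
      then have "\<bar>x / h\<bar> \<le> 1" using a h by (auto simp: abs_le_iff field_simps)
      then have "\<bar>poly (lagrange_poly Nf j) (x / h)\<bar> \<le> L" using L j by blast
      then have "\<bar>cos (real n * (x + c))\<bar> * \<bar>poly (lagrange_poly Nf j) (x / h)\<bar> \<le> 1 * L"
        by (intro mult_mono) auto
      then show "norm (cos (real n * (x + c)) * poly (lagrange_poly Nf j) (x / h)) \<le> L"
        by (simp add: abs_mult)
    qed (use a h in \<open>auto intro!: continuous_on_mult continuous_on_cos continuous_on_poly continuous_on_divide continuous_on_add continuous_on_const continuous_on_id\<close>)
    also have "L * (a - - a) \<le> 2 * L * h"
      using a L by (simp add: mult_left_mono)
    finally show "\<bar>filon_weights Nf N kg n m j\<bar> \<le> 2 * L * grid_step N"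
      by (simp add: filon_weights_eq [OF N j] h_def c_def a_def)
  qed
qed

section \<open>Defect of the moment conditions\<close>

lemma abs_cos_diff_le: "\<bar>cos x - cos y\<bar> \<le> \<bar>x - y\<bar>" for x y :: real
proof -
  have "\<bar>cos x - cos y\<bar> = 2 * (\<bar>sin ((x + y) / 2)\<bar> * \<bar>sin ((y - x) / 2)\<bar>)"
    by (simp add: cos_diff_cos abs_mult)
  also have "\<dots> \<le> 2 * (1 * \<bar>(y - x) / 2\<bar>)"
    by (intro mult_left_mono mult_mono abs_sin_le_one abs_sin_x_le_abs_x) auto
  finally show ?thesis by simp
qed

lemma integral_odd_eq_0:
  fixes g :: "real \<Rightarrow> real"
  assumes "\<And>x. g (- x) = - g x"
  shows "integral {- a..a} g = 0"
  using Henstock_Kurzweil_Integration.integral_reflect_real [where f = g and a = "- a" and b = a] by (simp add: assms)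

lemma moment_defect_bound:
  obtains D where "D \<ge> 0"
    "\<And>N kg m k. N > 0 \<Longrightarrow> k < Nf + region_width Nf \<Longrightarrow>
       \<bar>integral (reference_region Nf N) (\<lambda>x. cos (real n * (x + region_centre Nf N kg m)) * x ^ k)
         - (\<Sum>j\<le>Nf. filon_weights Nf N kg n m j * (offset Nf j * grid_step N) ^ k)\<bar>
       \<le> D * grid_step N ^ (Nf + region_width Nf + 1)"
proof -
  obtain L where L: "L \<ge> 0" "\<And>j s. j \<le> Nf \<Longrightarrow> \<bar>s\<bar> \<le> 1 \<Longrightarrow> \<bar>poly (lagrange_poly Nf j) s\<bar> \<le> L"
    by (rule lagrange_poly_bound [of Nf]) blast
  \<comment> \<open>The summand 1 accounts for \<open>x ^ k\<close>, the other for its interpolant: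
    \<open>Nf + 1\<close> terms, each at most \<open>Nf ^ (Nf + 1) * L\<close>.\<close>
  define C where "C = 1 + real (Suc Nf) * (real Nf ^ Suc Nf * L)"
  have C: "C \<ge> 0" using L by (simp add: C_def)
  show ?thesis
  proof
    show "2 * real n * C \<ge> 0" using C by simp
    fix N kg m k :: nat assume N: "N > 0" and k: "k < Nf + region_width Nf"
    define h c where "h = grid_step N" and "c = region_centre Nf N kg m"
    have h: "h > 0" using grid_step_pos [OF N] by (simp add: h_def)
    let ?I = "reference_region Nf N" and ?w = "filon_weights Nf N kg n m"
    show "\<bar>integral ?I (\<lambda>x. cos (real n * (x + region_centre Nf N kg m)) * x ^ k)
         - (\<Sum>j\<le>Nf. ?w j * (offset Nf j * grid_step N) ^ k)\<bar>
       \<le> 2 * real n * C * grid_step N ^ (Nf + region_width Nf + 1)"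
    proof (cases "k \<le> Nf")
      case True
      have "integral ?I (\<lambda>x. cos (real n * (x + region_centre Nf N kg m)) * x ^ k) =
          (\<Sum>j\<le>Nf. ?w j * (offset Nf j * grid_step N) ^ k)"
        using moment_conditions_filon_weights [OF N, of Nf kg n m, unfolded moment_conditions_def Let_def,
            rule_format, OF True, symmetric]
        by (simp add: offset_def sum_distrib_left power_mult_distrib mult_ac)
      then show ?thesis
        using C h by (simp add: h_def)
    next
      case False
      then have even: "even Nf" and k_eq: "k = Suc Nf" and q: "region_width Nf = 2"
        using k by (auto simp: region_width_def split: if_splits)
      have I: "?I = {-h..h}" by (simp add: q h_def)
      \<comment> \<open>Interpolation error of \<open>x ^ k\<close>, in the unscaled variable: an
        odd function of size \<open>O(h ^ k)\<close>.\<close>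
      define \<omega> where "\<omega> x = x ^ k - h ^ k * (\<Sum>j\<le>Nf. offset Nf j ^ k * poly (lagrange_poly Nf j) (x / h))" for x
      have cont: "continuous_on {-h..h} \<omega>"
        unfolding \<omega>_def using h by (intro continuous_intros) auto
      have odd: "\<omega> (- x) = - \<omega> x" for x
        using even interpolant_odd_power [of k Nf "x / h"] by (simp add: \<omega>_def k_eq)
      have bound: "\<bar>\<omega> x\<bar> \<le> h ^ k * C" if x: "x \<in> {-h..h}" for x
      proof -
        have xh: "\<bar>x\<bar> \<le> h" "\<bar>x / h\<bar> \<le> 1" using x h by (auto simp: abs_le_iff field_simps)
        have "\<bar>\<Sum>j\<le>Nf. offset Nf j ^ k * poly (lagrange_poly Nf j) (x / h)\<bar>
            \<le> (\<Sum>j\<le>Nf. real Nf ^ k * L)"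
          unfolding abs_mult power_abs
          by (intro order.trans [OF sum_abs] sum_mono)
             (auto simp: abs_mult power_abs intro!: mult_mono power_mono abs_offset_le L xh)
        also have "\<dots> = C - 1" by (simp add: C_def k_eq)
        finally have "h ^ k * \<bar>\<Sum>j\<le>Nf. offset Nf j ^ k * poly (lagrange_poly Nf j) (x / h)\<bar>
            \<le> h ^ k * (C - 1)"
          using h by (intro mult_left_mono) auto
        moreover have "\<bar>x ^ k\<bar> \<le> h ^ k"
          using xh by (simp add: power_abs power_mono)
        moreover have "\<bar>\<omega> x\<bar> \<le> \<bar>x ^ k\<bar> +
            h ^ k * \<bar>\<Sum>j\<le>Nf. offset Nf j ^ k * poly (lagrange_poly Nf j) (x / h)\<bar>"
          using abs_triangle_ineq4 [of "x ^ k"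
              "h ^ k * (\<Sum>j\<le>Nf. offset Nf j ^ k * poly (lagrange_poly Nf j) (x / h))"] h
          by (simp only: \<omega>_def abs_mult) (simp add: power_abs)
        ultimately show ?thesis by (simp add: algebra_simps)
      qed
      \<comment> \<open>The rule applied to \<open>x ^ k\<close> is the exact integral of the cosine
        times the interpolant, so the defect is the integral of the cosine times
        \<open>\<omega>\<close>.\<close>
      have "(\<Sum>j\<le>Nf. ?w j * (offset Nf j * h) ^ k) =
          (\<Sum>j\<le>Nf. integral {-h..h} (\<lambda>x. (offset Nf j * h) ^ k *
             (cos (real n * (x + c)) * poly (lagrange_poly Nf j) (x / h))))"
        by (rule sum.cong) (simp_all add: filon_weights_eq [OF N] I c_def h_def)
      also have "\<dots> = integral {-h..h} (\<lambda>x. \<Sum>j\<le>Nf. (offset Nf j * h) ^ k *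
             (cos (real n * (x + c)) * poly (lagrange_poly Nf j) (x / h)))"
        using h by (intro integral_sum [symmetric] integrable_continuous_real continuous_intros) auto
      also have "\<dots> = integral {-h..h} (\<lambda>x. cos (real n * (x + c)) *
             (h ^ k * (\<Sum>j\<le>Nf. offset Nf j ^ k * poly (lagrange_poly Nf j) (x / h))))"
        by (simp add: sum_distrib_left power_mult_distrib algebra_simps)
      finally have "integral {-h..h} (\<lambda>x. cos (real n * (x + c)) * x ^ k)
            - (\<Sum>j\<le>Nf. ?w j * (offset Nf j * h) ^ k)
          = integral {-h..h} (\<lambda>x. cos (real n * (x + c)) * x ^ k) - integral {-h..h} (\<lambda>x. cos (real n * (x + c)) *
             (h ^ k * (\<Sum>j\<le>Nf. offset Nf j ^ k * poly (lagrange_poly Nf j) (x / h))))"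
        by simp
      also have "\<dots> = integral {-h..h} (\<lambda>x. cos (real n * (x + c)) * \<omega> x)"
        unfolding \<omega>_def right_diff_distrib using h
        by (intro integral_diff [symmetric] integrable_continuous_real continuous_intros) auto
      \<comment> \<open>The subtracted term is zero by oddness; it allows the cosine to be replaced
        by its deviation from the value at the centre.\<close>
      also have "\<dots> = integral {-h..h} (\<lambda>x. cos (real n * (x + c)) * \<omega> x)
            - cos (real n * c) * integral {-h..h} \<omega>"
        by (simp add: integral_odd_eq_0 odd)
      also have "\<dots> = integral {-h..h} (\<lambda>x. (cos (real n * (x + c)) - cos (real n * c)) * \<omega> x)"
        unfolding left_diff_distrib integral_mult_right [symmetric]
        by (intro integral_diff [symmetric] integrable_continuous_real continuous_intros cont)
      \<comment> \<open>The factors are the Lipschitz bound \<open>n * h\<close> for the cosine, the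
        bound for \<open>\<omega>\<close> and the interval length \<open>2 * h\<close>.\<close>
      also have "norm \<dots> \<le> (real n * h * (h ^ k * C)) * (h - - h)"
      proof (rule integral_bound)
        show "continuous_on {-h..h} (\<lambda>x. (cos (real n * (x + c)) - cos (real n * c)) * \<omega> x)"
          by (intro continuous_intros cont)
        fix x assume x: "x \<in> {-h..h}"
        have "\<bar>cos (real n * (x + c)) - cos (real n * c)\<bar> \<le> \<bar>real n * (x + c) - real n * c\<bar>"
          by (rule abs_cos_diff_le)
        also have "\<dots> = real n * \<bar>x\<bar>"
          by (simp add: algebra_simps abs_mult)
        also have "\<dots> \<le> real n * h"
          using x by (intro mult_left_mono) auto
        finally show "norm ((cos (real n * (x + c)) - cos (real n * c)) * \<omega> x) \<le> real n * h * (h ^ k * C)"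
          unfolding real_norm_def abs_mult using bound [OF x] h by (intro mult_mono) auto
      qed (use h in simp)
      also have "\<dots> = 2 * real n * C * h ^ (Nf + region_width Nf + 1)"
        by (simp add: q k_eq)
      finally show ?thesis
        unfolding real_norm_def I [symmetric] unfolding h_def c_def .
    qed
  qed
qed

section \<open>Uniform Taylor expansions of an analytic function\<close>

text \<open>The coefficients may vary with the centre \<open>c\<close>, but the radius and the bound
  may not. The point \<open>c + x\<close> may leave \<open>S\<close>, as is needed for nodes outside
  the interval of integration.\<close>

definition uniform_taylor :: "(real \<Rightarrow> complex) \<Rightarrow> nat \<Rightarrow> real set \<Rightarrow> bool" where
  "uniform_taylor f K S \<longleftrightarrow>
     (\<exists>\<delta>>0. \<exists>M\<ge>0. \<forall>c\<in>S. \<exists>a. (\<forall>k\<le>K. norm (a k) \<le> M) \<and>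
        (\<forall>x. \<bar>x\<bar> \<le> \<delta> \<longrightarrow> norm (f (c + x) - (\<Sum>k\<le>K. x ^ k *\<^sub>R a k)) \<le> M * \<bar>x\<bar> ^ Suc K))"

text \<open>Convergence of the series at real points forces convergence on the complex disc of the
  same radius. The extension makes derivative bounds and the complex Taylor theorem
  available.\<close>

lemma real_analytic_at_holomorphic_extension:
  assumes "real_analytic_at f x"
  obtains r F where "r > 0" "F holomorphic_on ball (of_real x) r"
    "\<And>y. \<bar>y - x\<bar> < r \<Longrightarrow> f y = F (of_real y)"
proof -
  obtain r a where r: "r > 0" and
    sums: "\<And>y. \<bar>y - x\<bar> < r \<Longrightarrow> (\<lambda>k. ((y - x) ^ k) *\<^sub>R a k) sums f y"
    using assms unfolding real_analytic_at_def by blast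
  define F where "F z = (\<Sum>k. a k * (z - of_real x) ^ k)" for z :: complex
  show ?thesis
  proof
    show "r > 0" by (rule r)
    show "F holomorphic_on ball (of_real x) r"
    proof (rule power_series_holomorphic)
      fix w :: complex assume "w \<in> ball (of_real x) r"
      then have "norm (w - of_real x) < r" by (simp add: dist_norm norm_minus_commute)
      \<comment> \<open>The real point \<open>x + \<rho>\<close> lies strictly farther from
        \<open>x\<close> than \<open>w\<close>, so convergence there carries over to
        \<open>w\<close>.\<close>
      then obtain \<rho> where \<rho>: "norm (w - of_real x) < \<rho>" "\<rho> < r"
        using dense by blast
      then have "\<rho> > 0" by (meson norm_ge_zero order.strict_trans1)
      then have "summable (\<lambda>k. (\<rho> ^ k) *\<^sub>R a k)"
        using sums [of "x + \<rho>"] \<rho> by (simp add: sums_iff)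
      then have "summable (\<lambda>k. a k * of_real \<rho> ^ k)"
        by (simp add: scaleR_conv_of_real mult.commute)
      then have "summable (\<lambda>k. a k * (w - of_real x) ^ k)"
        by (rule powser_inside) (use \<rho> in simp)
      then show "(\<lambda>k. a k * (w - of_real x) ^ k) sums F w"
        unfolding F_def by (rule summable_sums)
    qed
    fix y assume "\<bar>y - x\<bar> < r"
    then show "f y = F (of_real y)"
      using sums [of y] unfolding F_def
      by (simp add: sums_iff scaleR_conv_of_real mult.commute)
  qed
qed

lemma real_analytic_at_continuous:
  assumes "real_analytic_at f x"
  shows "isCont f x"
proof -
  obtain r F where r: "r > 0" "F holomorphic_on ball (of_real x) r"
    "\<And>y. \<bar>y - x\<bar> < r \<Longrightarrow> f y = F (of_real y)"
    by (rule real_analytic_at_holomorphic_extension [OF assms]) blast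
  have "continuous_on (ball x r) (\<lambda>y. F (of_real y))"
    by (rule continuous_on_compose2 [OF holomorphic_on_imp_continuous_on [OF r(2)]])
       (auto intro!: continuous_intros simp: dist_norm norm_of_real simp flip: of_real_diff)
  then have "continuous_on (ball x r) f"
    by (rule continuous_on_cong [THEN iffD1, rotated 2])
       (auto simp: dist_real_def abs_minus_commute r(3))
  then show ?thesis
    using r(1) by (simp add: continuous_on_eq_continuous_at)
qed

lemma divide_fact_le: "0 \<le> x \<Longrightarrow> x / fact k \<le> x" for x :: real
  using divide_left_mono [of 1 "fact k" x] by simp

text \<open>Derivatives of the extension up to order \<open>K + 1\<close> are bounded on a smaller
  closed disc, by compactness. Centres within \<open>r / 4\<close> of \<open>x\<close> and
  increments up to \<open>r / 4\<close> stay inside that disc of radius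
  \<open>r / 2\<close>.\<close>

lemma uniform_taylor_local:
  assumes "real_analytic_at f x"
  shows "\<exists>e>0. uniform_taylor f K (ball x e)"
proof -
  obtain r F where r: "r > 0" and F: "F holomorphic_on ball (of_real x) r"
    and f: "\<And>y. \<bar>y - x\<bar> < r \<Longrightarrow> f y = F (of_real y)"
    by (rule real_analytic_at_holomorphic_extension [OF assms]) blast
  define S where "S = cball (complex_of_real x) (r / 2)"
  have S: "S \<subseteq> ball (of_real x) r" using r by (auto simp: S_def)
  have "compact (\<Union>i\<le>Suc K. (deriv ^^ i) F ` S)"
  proof (intro compact_UN compact_continuous_image)
    fix i show "continuous_on S ((deriv ^^ i) F)"
      by (rule continuous_on_subset [OF _ S])
         (intro holomorphic_on_imp_continuous_on holomorphic_higher_deriv F open_ball)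
  qed (auto simp: S_def)
  then obtain B where "\<forall>z\<in>(\<Union>i\<le>Suc K. (deriv ^^ i) F ` S). norm z \<le> B"
    using compact_imp_bounded bounded_iff by metis
  then have B: "norm ((deriv ^^ i) F z) \<le> B" if "i \<le> Suc K" "z \<in> S" for i z
    using that by blast
  have "B \<ge> 0"
    using norm_ge_zero [THEN order.trans, OF B [of 0 "of_real x"]] r by (simp add: S_def)
  have in_S: "of_real y \<in> S" if "\<bar>y - x\<bar> \<le> r / 2" for y
    using that by (simp add: S_def dist_norm abs_minus_commute flip: of_real_diff)
  have "uniform_taylor f K (ball x (r / 4))"
    unfolding uniform_taylor_def
  proof (intro exI conjI ballI allI impI)
    show "r / 4 > 0" "B \<ge> 0" using r \<open>B \<ge> 0\<close> by auto
    fix c assume "c \<in> ball x (r / 4)"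
    then have c: "\<bar>c - x\<bar> < r / 4" by (simp add: dist_real_def abs_minus_commute)
    have cS: "of_real c \<in> S" using c r by (intro in_S) auto
    \<comment> \<open>Taylor coefficients at \<open>c\<close>; dividing by the factorial only
      shrinks them, so \<open>B\<close> bounds them too.\<close>
    let ?a = "\<lambda>k. (deriv ^^ k) F (of_real c) / fact k"
    show "norm (?a k) \<le> B" if "k \<le> K" for k
    proof -
      have "norm (?a k) \<le> norm ((deriv ^^ k) F (of_real c))"
        by (simp add: norm_divide divide_fact_le)
      also have "\<dots> \<le> B" using that cS by (intro B) auto
      finally show ?thesis .
    qed
    fix t :: real assume t: "\<bar>t\<bar> \<le> r / 4"
    have "norm ((deriv ^^ 0) F (of_real (c + t)) -
        (\<Sum>i\<le>K. (deriv ^^ i) F (of_real c) * (of_real (c + t) - of_real c) ^ i / fact i))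
      \<le> B * norm (complex_of_real (c + t) - of_real c) ^ Suc K / fact K"
    proof (rule complex_Taylor [where S = S and f = "\<lambda>i. (deriv ^^ i) F"])
      show "convex S" by (simp add: S_def)
      show "((deriv ^^ i) F has_field_derivative (deriv ^^ Suc i) F z) (at z within S)"
        if "z \<in> S" for i z
        using has_field_derivative_higher_deriv [OF F open_ball, of z i] that S
        by (blast intro: has_field_derivative_at_within)
      show "of_real (c + t) \<in> S" using c t by (intro in_S) linarith
      show "norm ((deriv ^^ Suc K) F z) \<le> B" if "z \<in> S" for z
        by (rule B [OF order.refl that])
    qed (rule cS)
    also have "\<dots> = B * \<bar>t\<bar> ^ Suc K / fact K"
      by simp
    also have "\<dots> \<le> B * \<bar>t\<bar> ^ Suc K"
      using \<open>B \<ge> 0\<close> by (intro divide_fact_le) simp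
    also have "(deriv ^^ 0) F (of_real (c + t)) = f (c + t)"
    proof -
      have "\<bar>c + t - x\<bar> < r" using c t by linarith
      then show ?thesis by (simp add: f)
    qed
    finally show "norm (f (c + t) - (\<Sum>k\<le>K. t ^ k *\<^sub>R ?a k)) \<le> B * \<bar>t\<bar> ^ Suc K"
      by (simp add: scaleR_conv_of_real mult.commute)
  qed
  then show ?thesis
    using r by (intro exI [of _ "r / 4"]) auto
qed

lemma uniform_taylor_mono:
  assumes "uniform_taylor f K T" "S \<subseteq> T"
  shows "uniform_taylor f K S"
  using assms unfolding uniform_taylor_def by (meson subsetD)

text \<open>The smaller radius and the larger bound serve both sets.\<close>

lemma uniform_taylor_Un:
  assumes "uniform_taylor f K S" "uniform_taylor f K T"
  shows "uniform_taylor f K (S \<union> T)"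
proof -
  obtain d M where d: "d > 0" "M \<ge> 0" and
    S: "\<And>c. c \<in> S \<Longrightarrow> \<exists>a. (\<forall>k\<le>K. norm (a k) \<le> M) \<and>
        (\<forall>x. \<bar>x\<bar> \<le> d \<longrightarrow> norm (f (c + x) - (\<Sum>k\<le>K. x ^ k *\<^sub>R a k)) \<le> M * \<bar>x\<bar> ^ Suc K)"
    using assms(1) unfolding uniform_taylor_def by blast
  obtain d' M' where d': "d' > 0" "M' \<ge> 0" and
    T: "\<And>c. c \<in> T \<Longrightarrow> \<exists>a. (\<forall>k\<le>K. norm (a k) \<le> M') \<and>
        (\<forall>x. \<bar>x\<bar> \<le> d' \<longrightarrow> norm (f (c + x) - (\<Sum>k\<le>K. x ^ k *\<^sub>R a k)) \<le> M' * \<bar>x\<bar> ^ Suc K)"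
    using assms(2) unfolding uniform_taylor_def by blast
  have le: "M * \<bar>x\<bar> ^ Suc K \<le> max M M' * \<bar>x\<bar> ^ Suc K" "M' * \<bar>x\<bar> ^ Suc K \<le> max M M' * \<bar>x\<bar> ^ Suc K" for x :: real
    by (intro mult_right_mono; simp)+
  show ?thesis
    unfolding uniform_taylor_def
  proof (rule exI [of _ "min d d'"], rule conjI, use d d' in simp,
      rule exI [of _ "max M M'"], rule conjI, use d in simp, rule ballI)
    fix c assume "c \<in> S \<union> T"
    then show "\<exists>a. (\<forall>k\<le>K. norm (a k) \<le> max M M') \<and>
        (\<forall>x. \<bar>x\<bar> \<le> min d d' \<longrightarrow>
           norm (f (c + x) - (\<Sum>k\<le>K. x ^ k *\<^sub>R a k)) \<le> max M M' * \<bar>x\<bar> ^ Suc K)"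
    proof
      assume "c \<in> S"
      from S [OF this] show ?thesis
        by (meson le(1) max.coboundedI1 min.boundedE order.trans)
    next
      assume "c \<in> T"
      from T [OF this] show ?thesis
        by (meson le(2) max.coboundedI2 min.boundedE order.trans)
    qed
  qed
qed

text \<open>A finite subcover reduces the claim to finitely many local expansions, which are merged
  by unions.\<close>

lemma uniform_taylor_compact:
  assumes "compact S" "\<And>x. x \<in> S \<Longrightarrow> real_analytic_at f x"
  shows "uniform_taylor f K S"
proof -
  have "\<forall>x\<in>S. \<exists>e>0. uniform_taylor f K (ball x e)"
    using uniform_taylor_local assms(2) by blast
  then obtain e where e: "\<forall>x\<in>S. e x > 0 \<and> uniform_taylor f K (ball x (e x))"
    by (rule bchoice [THEN exE])
  obtain X where X: "X \<subseteq> S" "finite X" "S \<subseteq> (\<Union>x\<in>X. ball x (e x))"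
    by (rule compactE_image [OF assms(1), of S "\<lambda>x. ball x (e x)"]) (use e in auto)
  have "uniform_taylor f K (\<Union>x\<in>X. ball x (e x))"
    using X(2,1)
  proof (induction X rule: finite_induct)
    case empty
    show ?case by (auto simp: uniform_taylor_def intro!: exI [of _ 1])
  next
    case (insert x X)
    then show ?case by (simp add: e uniform_taylor_Un)
  qed
  then show ?thesis by (rule uniform_taylor_mono [OF _ X(3)])
qed

section \<open>Error bounds\<close>

text \<open>With \<open>f\<close> split into Taylor polynomial and remainder, the three summands of
  the constant bound the integral of the remainder, the rule applied to the remainder, and the
  moment defects weighted by the coefficients. The radius \<open>(Nf + 1) * h\<close> covers the
  region and all nodes.\<close>

lemma local_error_le:
  fixes f :: "real \<Rightarrow> complex" and a :: "nat \<Rightarrow> complex"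
  assumes N: "N > 0"
    and defect: "\<And>k. k \<le> K \<Longrightarrow>
       \<bar>integral (reference_region Nf N) (\<lambda>x. cos (real n * (x + region_centre Nf N kg m)) * x ^ k)
         - (\<Sum>j\<le>Nf. filon_weights Nf N kg n m j * (offset Nf j * grid_step N) ^ k)\<bar>
       \<le> D * grid_step N ^ (K + 2)"
    and weights: "\<And>j. j \<le> Nf \<Longrightarrow> \<bar>filon_weights Nf N kg n m j\<bar> \<le> B * grid_step N"
    and coeffs: "\<And>k. k \<le> K \<Longrightarrow> norm (a k) \<le> M"
    and remainder: "\<And>x. \<bar>x\<bar> \<le> real (Suc Nf) * grid_step N \<Longrightarrow>
       norm (f (region_centre Nf N kg m + x) - (\<Sum>k\<le>K. x ^ k *\<^sub>R a k)) \<le> M * \<bar>x\<bar> ^ Suc K"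
    and cont: "continuous_on {region_left Nf N kg m..region_left Nf N kg (m + 1)} f"
    and nonneg: "D \<ge> 0" "B \<ge> 0" "M \<ge> 0"
  shows "norm (local_error Nf N kg n m f) \<le>
     (2 * M + real (Suc Nf) * (B * (M * real Nf ^ Suc K)) + real (Suc K) * (D * M)) * grid_step N ^ (K + 2)"
proof -
  define h c r w where "h = grid_step N" and "c = region_centre Nf N kg m"
    and "r = real (region_width Nf) * h / 2" and "w = filon_weights Nf N kg n m"
  have h: "h > 0" using grid_step_pos [OF N] by (simp add: h_def)
  have r: "0 \<le> r" "r \<le> h" using half_region_width_le [of h] h by (auto simp: r_def)
  have left: "region_left Nf N kg m = c - r" and right: "region_left Nf N kg (m + 1) = c + r"
    by (simp_all add: region_left_def c_def r_def h_def region_centre_def field_simps)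
  \<comment> \<open>For odd \<open>Nf\<close> the half lost in the floor matches the half step in
    the centre; for even \<open>Nf\<close> the centre is itself a grid point.\<close>
  have node: "filon_node Nf N kg m j = c + offset Nf j * h" for j
  proof (cases "even Nf")
    case True
    then show ?thesis
      by (auto simp: filon_node_def c_def region_centre_def offset_def region_width_def h_def field_simps
          elim!: evenE)
  next
    case False
    then show ?thesis
      by (auto simp: filon_node_def c_def region_centre_def offset_def region_width_def h_def field_simps
          elim!: oddE)
  qed
  define R where "R x = f (c + x) - (\<Sum>k\<le>K. x ^ k *\<^sub>R a k)" for x
  have f_eq: "f (c + x) = R x + (\<Sum>k\<le>K. x ^ k *\<^sub>R a k)" for x by (simp add: R_def)
  \<comment> \<open>Applied with \<open>y = h\<close> on the region and with
    \<open>y = Nf * h\<close> at the nodes.\<close>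
  have R_bound: "norm (R x) \<le> M * y ^ Suc K" if "\<bar>x\<bar> \<le> y" "y \<le> real (Suc Nf) * h" for x y
  proof -
    have "norm (R x) \<le> M * \<bar>x\<bar> ^ Suc K"
      unfolding R_def c_def using that by (intro remainder) (simp add: h_def)
    also have "\<dots> \<le> M * y ^ Suc K"
      using that nonneg by (intro mult_left_mono power_mono) auto
    finally show ?thesis .
  qed
  have cont_R: "continuous_on {-r..r} R"
    unfolding R_def
    by (intro continuous_intros continuous_on_compose2 [OF cont]) (auto simp: left right [unfolded Suc_eq_plus1 [symmetric]])
  \<comment> \<open>\<open>\<mu>\<close> collects the exact moments and \<open>\<nu>\<close> the
    values of the rule on the same powers; the assumption \<open>defect\<close> bounds their
    difference.\<close>
  define \<mu> where "\<mu> k = integral {-r..r} (\<lambda>x. cos (real n * (x + c)) * x ^ k)" for k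
  define \<nu> where "\<nu> k = (\<Sum>j\<le>Nf. w j * (offset Nf j * h) ^ k)" for k
  have "integral {c - r..c + r} (\<lambda>x. cos (real n * x) *\<^sub>R f x)
      = integral {-r..r} (\<lambda>x. cos (real n * (x + c)) *\<^sub>R f (c + x))"
    using integral_shift_real_ivl [of "c - r" c "c + r" "\<lambda>x. cos (real n * x) *\<^sub>R f x"]
    by (simp add: add.commute)
  also have "\<dots> = integral {-r..r} (\<lambda>x. cos (real n * (x + c)) *\<^sub>R R x +
      (\<Sum>k\<le>K. (cos (real n * (x + c)) * x ^ k) *\<^sub>R a k))"
    by (simp add: f_eq scaleR_add_right scaleR_sum_right)
  also have "\<dots> = integral {-r..r} (\<lambda>x. cos (real n * (x + c)) *\<^sub>R R x) +
      integral {-r..r} (\<lambda>x. \<Sum>k\<le>K. (cos (real n * (x + c)) * x ^ k) *\<^sub>R a k)"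
    by (intro integral_add integrable_continuous_real continuous_intros cont_R)
  also have "integral {-r..r} (\<lambda>x. \<Sum>k\<le>K. (cos (real n * (x + c)) * x ^ k) *\<^sub>R a k) =
      (\<Sum>k\<le>K. integral {-r..r} (\<lambda>x. (cos (real n * (x + c)) * x ^ k) *\<^sub>R a k))"
    by (intro integral_sum integrable_continuous_real continuous_intros) auto
  also have "\<dots> = (\<Sum>k\<le>K. \<mu> k *\<^sub>R a k)"
    unfolding \<mu>_def
    by (intro sum.cong refl integral_unique has_integral_scaleR_left integrable_integral
        integrable_continuous_real continuous_intros)
  finally have int_eq: "integral {c - r..c + r} (\<lambda>x. cos (real n * x) *\<^sub>R f x) =
      integral {-r..r} (\<lambda>x. cos (real n * (x + c)) *\<^sub>R R x) + (\<Sum>k\<le>K. \<mu> k *\<^sub>R a k)" .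
  have "filon_rule Nf N kg n m f =
      (\<Sum>j\<le>Nf. w j *\<^sub>R R (offset Nf j * h)) +
      (\<Sum>j\<le>Nf. \<Sum>k\<le>K. (w j * (offset Nf j * h) ^ k) *\<^sub>R a k)"
    by (simp add: filon_rule_def w_def node f_eq scaleR_add_right scaleR_sum_right sum.distrib)
  also have "(\<Sum>j\<le>Nf. \<Sum>k\<le>K. (w j * (offset Nf j * h) ^ k) *\<^sub>R a k) = (\<Sum>k\<le>K. \<nu> k *\<^sub>R a k)"
    unfolding \<nu>_def by (subst sum.swap) (simp add: scaleR_sum_left)
  finally have "local_error Nf N kg n m f =
      integral {-r..r} (\<lambda>x. cos (real n * (x + c)) *\<^sub>R R x)
      - (\<Sum>j\<le>Nf. w j *\<^sub>R R (offset Nf j * h)) + (\<Sum>k\<le>K. (\<mu> k - \<nu> k) *\<^sub>R a k)"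
    unfolding local_error_def left right int_eq
    by (simp add: scaleR_diff_left sum_subtractf)
  moreover have "norm (integral {-r..r} (\<lambda>x. cos (real n * (x + c)) *\<^sub>R R x)) \<le> 2 * M * h ^ (K + 2)"
  proof -
    have "norm (integral {-r..r} (\<lambda>x. cos (real n * (x + c)) *\<^sub>R R x)) \<le> (1 * (M * h ^ Suc K)) * (r - - r)"
    proof (rule integral_bound)
      show "continuous_on {-r..r} (\<lambda>x. cos (real n * (x + c)) *\<^sub>R R x)"
        by (intro continuous_intros cont_R)
      fix x assume x: "x \<in> {-r..r}"
      have "norm (R x) \<le> M * h ^ Suc K"
        using x r h by (intro R_bound) auto
      then show "norm (cos (real n * (x + c)) *\<^sub>R R x) \<le> 1 * (M * h ^ Suc K)"
        unfolding norm_scaleR by (intro mult_mono) auto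
    qed (use r in simp)
    also have "\<dots> \<le> (1 * (M * h ^ Suc K)) * (2 * h)"
      using r nonneg h by (intro mult_left_mono) auto
    finally show ?thesis by (simp add: mult_ac)
  qed
  moreover have "norm (\<Sum>j\<le>Nf. w j *\<^sub>R R (offset Nf j * h)) \<le>
      real (Suc Nf) * (B * (M * real Nf ^ Suc K)) * h ^ (K + 2)"
  proof -
    have "norm (\<Sum>j\<le>Nf. w j *\<^sub>R R (offset Nf j * h)) \<le> (\<Sum>j\<le>Nf. (B * h) * (M * (real Nf * h) ^ Suc K))"
    proof (intro sum_norm_le)
      fix j assume "j \<in> {..Nf}"
      then have j: "j \<le> Nf" by simp
      have "\<bar>offset Nf j * h\<bar> \<le> real Nf * h"
        using h abs_offset_le [OF j] by (simp add: abs_mult)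
      then have "norm (R (offset Nf j * h)) \<le> M * (real Nf * h) ^ Suc K"
        using h by (intro R_bound) auto
      then show "norm (w j *\<^sub>R R (offset Nf j * h)) \<le> (B * h) * (M * (real Nf * h) ^ Suc K)"
        unfolding norm_scaleR using weights [OF j] nonneg h
        by (intro mult_mono) (auto simp: w_def h_def)
    qed
    also have "\<dots> = real (Suc Nf) * (B * (M * real Nf ^ Suc K)) * h ^ (K + 2)"
      by (simp add: power_mult_distrib mult_ac)
    finally show ?thesis .
  qed
  moreover have "norm (\<Sum>k\<le>K. (\<mu> k - \<nu> k) *\<^sub>R a k) \<le> real (Suc K) * (D * M) * h ^ (K + 2)"
  proof -
    have "norm (\<Sum>k\<le>K. (\<mu> k - \<nu> k) *\<^sub>R a k) \<le> (\<Sum>k\<le>K. (D * h ^ (K + 2)) * M)"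
    proof (intro sum_norm_le)
      fix k assume "k \<in> {..K}"
      then have k: "k \<le> K" by simp
      show "norm ((\<mu> k - \<nu> k) *\<^sub>R a k) \<le> (D * h ^ (K + 2)) * M"
        unfolding norm_scaleR
        using defect [OF k] coeffs [OF k] nonneg h
        by (intro mult_mono) (auto simp: \<mu>_def \<nu>_def w_def h_def c_def r_def)
    qed
    then show ?thesis by (simp add: mult_ac)
  qed
  ultimately have "norm (local_error Nf N kg n m f) \<le>
      2 * M * h ^ (K + 2) + real (Suc Nf) * (B * (M * real Nf ^ Suc K)) * h ^ (K + 2)
      + real (Suc K) * (D * M) * h ^ (K + 2)"
    by (simp only:) (intro norm_triangle_le add_mono norm_triangle_le_diff)
  then show ?thesis
    by (simp only: h_def distrib_right)
qed

section \<open>Geometry of the regions and splitting of the global integral\<close>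

lemma region_left_0: "region_left Nf N kg 0 = real kg * grid_step N"
  by (simp add: region_left_def)

lemma region_left_mono: "i \<le> j \<Longrightarrow> region_left Nf N kg i \<le> region_left Nf N kg j"
  unfolding region_left_def by (intro mult_right_mono) (auto simp: grid_step_def mult_left_mono)

lemma region_left_le_pi:
  assumes "N > 0" "kg \<le> N" "m \<le> region_count Nf N kg"
  shows "region_left Nf N kg m \<le> pi"
proof -
  have "region_width Nf * m \<le> region_width Nf * ((N - kg) div region_width Nf)"
    using assms(3) by (simp add: region_count_def)
  also have "\<dots> \<le> N - kg" by simp
  finally have "kg + region_width Nf * m \<le> N" using assms(2) by simp
  then have "region_left Nf N kg m \<le> real N * grid_step N"
    unfolding region_left_def of_nat_le_iff
    by (intro mult_right_mono) (simp_all add: grid_step_def flip: of_nat_mult of_nat_add)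
  then show ?thesis
    using assms(1) by (simp add: grid_step_def)
qed

text \<open>Under the parity assumption the width divides \<open>N - kg\<close>, so the regions
  reach \<open>pi\<close> exactly.\<close>

lemma region_left_region_count:
  assumes "N > 0" "kg \<le> N" "even Nf \<Longrightarrow> even (N - kg)"
  shows "region_left Nf N kg (region_count Nf N kg) = pi"
proof -
  have "kg + region_width Nf * region_count Nf N kg = N"
    using assms(2,3) by (auto simp: region_count_def region_width_def)
  then show ?thesis
    using assms(1) by (simp add: region_left_def grid_step_def)
qed

text \<open>The integral is additive over adjacent regions, by induction on their number; continuity
  supplies integrability.\<close>

lemma global_error_eq_sum_local_error:
  assumes "N > 0" "kg \<le> N" "even Nf \<Longrightarrow> even (N - kg)"
    and cont: "continuous_on {real kg * grid_step N..pi} f"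
  shows "global_error Nf N kg n f = (\<Sum>m<region_count Nf N kg. local_error Nf N kg n m f)"
proof -
  define g where "g = (\<lambda>x. cos (real n * x) *\<^sub>R f x)"
  have split: "integral {region_left Nf N kg 0..region_left Nf N kg k} g =
      (\<Sum>m<k. integral {region_left Nf N kg m..region_left Nf N kg (m + 1)} g)"
    if "k \<le> region_count Nf N kg" for k
    using that
  proof (induction k)
    case 0
    show ?case by simp
  next
    case (Suc k)
    have "g integrable_on {region_left Nf N kg 0..region_left Nf N kg (Suc k)}"
      unfolding g_def region_left_0
      by (intro integrable_continuous_real continuous_intros continuous_on_subset [OF cont])
         (use region_left_le_pi [OF assms(1,2) Suc.prems] in auto)
    then have "integral {region_left Nf N kg 0..region_left Nf N kg (Suc k)} g =
        integral {region_left Nf N kg 0..region_left Nf N kg k} g +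
        integral {region_left Nf N kg k..region_left Nf N kg (Suc k)} g"
      by (intro Henstock_Kurzweil_Integration.integral_combine [symmetric] region_left_mono) auto
    then show ?case
      using Suc by simp
  qed
  have "integral {real kg * grid_step N..pi} g =
      (\<Sum>m<region_count Nf N kg. integral {region_left Nf N kg m..region_left Nf N kg (m + 1)} g)"
    using split [OF order.refl] region_left_region_count [OF assms(1-3)] by (simp add: region_left_0)
  then show ?thesis
    by (simp add: global_error_def local_error_def sum_subtractf g_def)
qed

section \<open>Bounds along a sequence of refined grids\<close>

lemma grid_step_tendsto_0:
  assumes "strict_mono N"
  shows "(\<lambda>i. grid_step (N i)) \<longlonglongrightarrow> 0"
proof -
  have "filterlim (\<lambda>i. real (N i)) at_top sequentially"
    by (rule filterlim_compose [OF filterlim_real_sequentially filterlim_subseq [OF assms]])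
  then show ?thesis
    unfolding grid_step_def by (intro tendsto_divide_0 [OF tendsto_const]) (rule filterlim_at_top_imp_at_infinity)
qed

text \<open>The common lower limit \<open>A\<close> puts the regions of all grids into one compact
  interval, so a single Taylor radius and bound serve every \<open>i\<close> and
  \<open>m\<close>.\<close>

lemma local_error_uniform_bound:
  fixes f :: "real \<Rightarrow> complex" and N kg :: "nat \<Rightarrow> nat"
  assumes N_pos: "\<And>i. N i > 0"
    and N_increasing: "strict_mono N"
    and kg_le: "\<And>i. kg i \<le> N i"
    and lower: "\<And>i. A \<le> real (kg i) * grid_step (N i)"
    and f_analytic: "\<And>x. x \<in> {A..pi} \<Longrightarrow> real_analytic_at f x"
  shows "\<exists>C. \<forall>\<^sub>F i in sequentially. \<forall>m<region_count Nf (N i) (kg i).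
    norm (local_error Nf (N i) (kg i) n m f) \<le> C * grid_step (N i) ^ (Nf + region_width Nf + 1)"
proof -
  \<comment> \<open>Taylor degree \<open>K\<close>: equal to \<open>Nf\<close> for odd and to
    \<open>Nf + 1\<close> for even \<open>Nf\<close>, the largest power covered by the defect
    bound.\<close>
  obtain K where K: "Nf + region_width Nf = Suc K"
    by (cases "Nf + region_width Nf") (auto simp: region_width_def split: if_splits)
  obtain B where B: "B \<ge> 0" "\<And>N kg n m j. N > 0 \<Longrightarrow> j \<le> Nf \<Longrightarrow>
      \<bar>filon_weights Nf N kg n m j\<bar> \<le> B * grid_step N"
    by (rule filon_weights_bound [of Nf]) blast
  obtain D where D: "D \<ge> 0" "\<And>N kg m k. N > 0 \<Longrightarrow> k < Nf + region_width Nf \<Longrightarrow>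
       \<bar>integral (reference_region Nf N) (\<lambda>x. cos (real n * (x + region_centre Nf N kg m)) * x ^ k)
         - (\<Sum>j\<le>Nf. filon_weights Nf N kg n m j * (offset Nf j * grid_step N) ^ k)\<bar>
       \<le> D * grid_step N ^ (Nf + region_width Nf + 1)"
    by (rule moment_defect_bound [of Nf n]) blast
  have "uniform_taylor f K {A..pi}"
    by (rule uniform_taylor_compact) (use f_analytic in auto)
  then obtain d M where d: "d > 0" and M: "M \<ge> 0" and taylor: "\<And>c. c \<in> {A..pi} \<Longrightarrow>
      \<exists>a. (\<forall>k\<le>K. norm (a k) \<le> M) \<and>
        (\<forall>x. \<bar>x\<bar> \<le> d \<longrightarrow> norm (f (c + x) - (\<Sum>k\<le>K. x ^ k *\<^sub>R a k)) \<le> M * \<bar>x\<bar> ^ Suc K)"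
    unfolding uniform_taylor_def by blast
  \<comment> \<open>Eventually all nodes lie within the Taylor radius of their centre. Coarser grids
    may have nodes where nothing is known about \<open>f\<close>, hence the restriction to large
    \<open>i\<close>.\<close>
  have "(\<lambda>i. real (Suc Nf) * grid_step (N i)) \<longlonglongrightarrow> 0"
    using tendsto_mult_right_zero [OF grid_step_tendsto_0 [OF N_increasing]] .
  then have small: "\<forall>\<^sub>F i in sequentially. real (Suc Nf) * grid_step (N i) < d"
    by (rule order_tendstoD) (rule d)
  show ?thesis
  proof (intro exI, rule eventually_mono [OF small], intro allI impI)
    fix i m assume i: "real (Suc Nf) * grid_step (N i) < d"
      and m: "m < region_count Nf (N i) (kg i)"
    let ?l = "region_left Nf (N i) (kg i)" and ?c = "region_centre Nf (N i) (kg i) m"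
    have sub: "{?l m..?l (m + 1)} \<subseteq> {A..pi}"
      using region_left_le_pi [OF N_pos kg_le, of "m + 1" Nf i] m lower [of i]
        region_left_mono [of 0 m Nf "N i" "kg i"] by (auto simp: region_left_0)
    have "?c \<in> {?l m..?l (m + 1)}"
      using grid_step_pos [OF N_pos, of i]
      unfolding region_centre_def region_left_def atLeastAtMost_iff
      by (intro conjI mult_right_mono) (simp_all add: algebra_simps)
    then obtain a where a: "\<And>k. k \<le> K \<Longrightarrow> norm (a k) \<le> M"
      "\<And>x. \<bar>x\<bar> \<le> d \<Longrightarrow> norm (f (?c + x) - (\<Sum>k\<le>K. x ^ k *\<^sub>R a k)) \<le> M * \<bar>x\<bar> ^ Suc K"
      using taylor sub by blast
    show "norm (local_error Nf (N i) (kg i) n m f) \<le>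
      (2 * M + real (Suc Nf) * (B * (M * real Nf ^ Suc K)) + real (Suc K) * (D * M))
        * grid_step (N i) ^ (Nf + region_width Nf + 1)"
      unfolding K Suc_eq_plus1 [symmetric] add_2_eq_Suc' [symmetric]
    proof (rule local_error_le [OF N_pos _ _ a(1)])
      show "\<bar>integral (reference_region Nf (N i)) (\<lambda>x. cos (real n * (x + ?c)) * x ^ k)
         - (\<Sum>j\<le>Nf. filon_weights Nf (N i) (kg i) n m j * (offset Nf j * grid_step (N i)) ^ k)\<bar>
       \<le> D * grid_step (N i) ^ (K + 2)" if "k \<le> K" for k
        using D(2) [OF N_pos, of k i "kg i" m] that by (simp add: K)
      show "continuous_on {?l m..?l (m + 1)} f"
        using sub f_analytic
        by (intro continuous_at_imp_continuous_on) (auto intro: real_analytic_at_continuous)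
    qed (use B(2) [OF N_pos] a(2) i B(1) D(1) M in auto)
  qed
qed

theorem mainTheorem7:
  fixes Nf :: nat and N kg :: "nat \<Rightarrow> nat" and f :: "real \<Rightarrow> complex"
  assumes N_pos: "\<And>i. N i > 0"
    and N_increasing: "strict_mono N"
    and kg_le: "\<And>i. kg i \<le> N i"
    and parity: "\<And>i. even Nf \<Longrightarrow> even (N i - kg i)"
    and hg_not_reduced: "mono (\<lambda>i. real (kg i) * grid_step (N i))"
    and f_analytic: "\<And>i x. x \<in> {real (kg i) * grid_step (N i)..pi} \<Longrightarrow> real_analytic_at f x"
  shows "(\<forall>n. (\<lambda>i. norm (global_error Nf (N i) (kg i) n f))
                \<in> O(\<lambda>i. grid_step (N i) ^ (Nf + region_width Nf))) \<and>
         (even Nf \<longrightarrow>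
           (\<forall>n. \<exists>C. \<forall>\<^sub>F i in sequentially. \<forall>m<region_count Nf (N i) (kg i).
              norm (local_error Nf (N i) (kg i) n m f) \<le> C * grid_step (N i) ^ (Nf + 3)))"
proof -
  \<comment> \<open>By monotonicity the first left endpoint is the smallest, so analyticity for
    index 0 covers all grids.\<close>
  let ?A = "real (kg 0) * grid_step (N 0)"
  have lower: "?A \<le> real (kg i) * grid_step (N i)" for i
    using monoD [OF hg_not_reduced, of 0 i] by simp
  have local_bound: "\<exists>C. \<forall>\<^sub>F i in sequentially. \<forall>m<region_count Nf (N i) (kg i).
    norm (local_error Nf (N i) (kg i) n m f) \<le> C * grid_step (N i) ^ (Nf + region_width Nf + 1)" for n
    by (rule local_error_uniform_bound [OF N_pos N_increasing kg_le lower f_analytic])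
  have "(\<lambda>i. norm (global_error Nf (N i) (kg i) n f))
      \<in> O(\<lambda>i. grid_step (N i) ^ (Nf + region_width Nf))" for n
  proof -
    obtain C where C: "\<forall>\<^sub>F i in sequentially. \<forall>m<region_count Nf (N i) (kg i).
      norm (local_error Nf (N i) (kg i) n m f) \<le> C * grid_step (N i) ^ (Nf + region_width Nf + 1)"
      using local_bound by blast
    show ?thesis
    \<comment> \<open>Here \<open>pi\<close> is \<open>N * h\<close>, which bounds the number of
      regions times the step; the absolute value is taken because \<open>C\<close> carries no sign
      information.\<close>
    proof (rule bigoI [where c = "pi * \<bar>C\<bar>"], rule eventually_mono [OF C])
      fix i assume i: "\<forall>m<region_count Nf (N i) (kg i).
        norm (local_error Nf (N i) (kg i) n m f) \<le> C * grid_step (N i) ^ (Nf + region_width Nf + 1)"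
      define h where "h = grid_step (N i)"
      have h: "h > 0" using grid_step_pos [OF N_pos] by (simp add: h_def)
      have "continuous_on {real (kg i) * grid_step (N i)..pi} f"
        by (intro continuous_at_imp_continuous_on ballI real_analytic_at_continuous f_analytic)
      then have "norm (global_error Nf (N i) (kg i) n f) =
          norm (\<Sum>m<region_count Nf (N i) (kg i). local_error Nf (N i) (kg i) n m f)"
        by (subst global_error_eq_sum_local_error [OF N_pos kg_le parity]) auto
      also have "\<dots> \<le> (\<Sum>m<region_count Nf (N i) (kg i). \<bar>C\<bar> * h ^ (Nf + region_width Nf + 1))"
      proof (rule sum_norm_le)
        fix m assume "m \<in> {..<region_count Nf (N i) (kg i)}"
        then have "norm (local_error Nf (N i) (kg i) n m f) \<le> C * h ^ (Nf + region_width Nf + 1)"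
          using i by (simp add: h_def)
        also have "\<dots> \<le> \<bar>C\<bar> * h ^ (Nf + region_width Nf + 1)"
          using h by (intro mult_right_mono) auto
        finally show "norm (local_error Nf (N i) (kg i) n m f) \<le> \<bar>C\<bar> * h ^ (Nf + region_width Nf + 1)" .
      qed
      \<comment> \<open>One power of \<open>h\<close> is spent on the number of regions, which turns
        the local order into the global one.\<close>
      also have "\<dots> = (real (region_count Nf (N i) (kg i)) * h) * (\<bar>C\<bar> * h ^ (Nf + region_width Nf))"
        by simp
      also have "\<dots> \<le> pi * (\<bar>C\<bar> * h ^ (Nf + region_width Nf))"
      proof (rule mult_right_mono)
        have "real (region_count Nf (N i) (kg i)) \<le> real (N i)"
          unfolding region_count_def of_nat_le_iff by (meson diff_le_self div_le_dividend order.trans)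
        then have "real (region_count Nf (N i) (kg i)) * h \<le> real (N i) * h"
          using h by (intro mult_right_mono) auto
        also have "real (N i) * h = pi"
          using N_pos [of i] by (simp add: h_def grid_step_def)
        finally show "real (region_count Nf (N i) (kg i)) * h \<le> pi" .
      qed (use h in simp)
      finally show "norm (norm (global_error Nf (N i) (kg i) n f)) \<le>
          pi * \<bar>C\<bar> * norm (grid_step (N i) ^ (Nf + region_width Nf))"
        using h by (simp add: h_def)
    qed
  qed
  moreover have "\<exists>C. \<forall>\<^sub>F i in sequentially. \<forall>m<region_count Nf (N i) (kg i).
      norm (local_error Nf (N i) (kg i) n m f) \<le> C * grid_step (N i) ^ (Nf + 3)" if "even Nf" for n
  proof -
    have "Nf + region_width Nf + 1 = Nf + 3"
      using that by (simp add: region_width_def)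
    then show ?thesis
      using local_bound [of n] by (simp only:)
  qed
  ultimately show ?thesis
    by blast
qed

end
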